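(* Let $m,n$ be positive integers, let $l,u\in\mathbb{R}_+^m$, $l',u'\in\mathbb{R}_+^n$ and $L,U\in\mathbb{R}_+$ satisfy $u\ge l$, $u'\ge l'$, $U\ge L$, $u>0$ and $u'>0$ (componentwise). With $\tilde{\mathcal{T}}(l,u,l',u',L,U)$ and $\tilde{\mathcal{T}}^2(l,u,l',u',L,U)$ as defined in the context, $$\tilde{\mathcal{T}}(l,u,l',u',L,U)=\tilde{\mathcal{T}}^2(l,u,l',u',L,U).$$
   Context: $[k]=\{1,\dots,k\}$; $\mathbb{R}_+$ denotes the nonnegative reals; $X=(x_{ij})$, $R=(r_{ij})$. $\tilde{\mathcal{T}}(l,u,l',u',L,U)$ is the set of $X\in\mathbb{R}_+^{m\times n}$ with $\operatorname{rank}(X)\le1$, $l_i\le\sum_{j=1}^n x_{ij}\le u_i$ for all $i\in[m]$, $l'_j\le\sum_{i=1}^m x_{ij}\le u'_j$ for all $j\in[n]$, and $L\le\sum_{i=1}^m\sum_{j=1}^n x_{ij}\le U$. $\tilde{\mathcal{T}}^2(l,u,l',u',L,U)$ is the set of $X\in\mathbb{R}_+^{m\times n}$ with $\operatorname{rank}(X)\le 1$ for which there exists $R\in\mathbb{R}_+^{m\times n}$ such that, for all $i\in[m]$, $j\in[n]$, $$l_i\sum_{i'=1}^m r_{i'j}\le x_{ij}\le u_i\sum_{i'=1}^m r_{i'j},\qquad Lr_{ij}\le x_{ij}\le Ur_{ij},\qquad l'_j\sum_{j'=1}^n r_{ij'}\le x_{ij}\le u'_j\sum_{j'=1}^n r_{ij'},$$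 $$x_{ij}=r_{ij}\sum_{i'=1}^m\sum_{j'=1}^n x_{i'j'},$$ and $\sum_{i=1}^m\sum_{j=1}^n r_{ij}=1$. *)

theory Defs
  imports "HOL-Analysis.Analysis"
begin

definition nonneg_matrix :: "real ^ 'n ^ 'm \<Rightarrow> bool" where
  "nonneg_matrix X \<longleftrightarrow> (\<forall>i j. 0 \<le> X $ i $ j)"

text \<open>
  Here \<open>l\<close>, \<open>u\<close> bound the row sums, \<open>l'\<close>, \<open>u'\<close> the column sums and \<open>L\<close>, \<open>U\<close> the total sum.
\<close>

definition rank1_transport ::
  "real ^ 'm \<Rightarrow> real ^ 'm \<Rightarrow> real ^ 'n \<Rightarrow> real ^ 'n \<Rightarrow> real \<Rightarrow> real \<Rightarrow> (real ^ 'n ^ 'm) set" where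
  "rank1_transport l u l' u' L U =
    {X. nonneg_matrix X \<and> rank X \<le> 1 \<and>
        (\<forall>i. l $ i \<le> (\<Sum>j\<in>UNIV. X $ i $ j) \<and> (\<Sum>j\<in>UNIV. X $ i $ j) \<le> u $ i) \<and>
        (\<forall>j. l' $ j \<le> (\<Sum>i\<in>UNIV. X $ i $ j) \<and> (\<Sum>i\<in>UNIV. X $ i $ j) \<le> u' $ j) \<and>
        L \<le> (\<Sum>i\<in>UNIV. \<Sum>j\<in>UNIV. X $ i $ j) \<and> (\<Sum>i\<in>UNIV. \<Sum>j\<in>UNIV. X $ i $ j) \<le> U}"

definition rank1_transport2 ::
  "real ^ 'm \<Rightarrow> real ^ 'm \<Rightarrow> real ^ 'n \<Rightarrow> real ^ 'n \<Rightarrow> real \<Rightarrow> real \<Rightarrow> (real ^ 'n ^ 'm) set" where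
  "rank1_transport2 l u l' u' L U =
    {X. nonneg_matrix X \<and> rank X \<le> 1 \<and>
        (\<exists>R :: real ^ 'n ^ 'm. nonneg_matrix R \<and>
          (\<forall>i j.
            l $ i * (\<Sum>i'\<in>UNIV. R $ i' $ j) \<le> X $ i $ j \<and>
            X $ i $ j \<le> u $ i * (\<Sum>i'\<in>UNIV. R $ i' $ j) \<and>
            L * R $ i $ j \<le> X $ i $ j \<and>
            X $ i $ j \<le> U * R $ i $ j \<and>
            l' $ j * (\<Sum>j'\<in>UNIV. R $ i $ j') \<le> X $ i $ j \<and>
            X $ i $ j \<le> u' $ j * (\<Sum>j'\<in>UNIV. R $ i $ j') \<and>
            X $ i $ j = R $ i $ j * (\<Sum>i'\<in>UNIV. \<Sum>j'\<in>UNIV. X $ i' $ j')) \<and>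
          (\<Sum>i\<in>UNIV. \<Sum>j\<in>UNIV. R $ i $ j) = 1)}"

end

theory Submission
  imports Defs
begin

text \<open>
  A matrix of rank at most 1 satisfies \<open>x\<^sub>i\<^sub>j S = \<rho>\<^sub>i \<gamma>\<^sub>j\<close>, where \<open>S\<close> is the total sum and \<open>\<rho>\<close>, \<open>\<gamma>\<close>
  are the row and column sums. Hence for \<open>S > 0\<close> the matrix \<open>R = X / S\<close> turns the marginal bounds
  into the entrywise ones; for \<open>S = 0\<close> all lower bounds vanish and any \<open>R\<close> of total mass 1 works.
  Conversely, summing the entrywise bounds over \<open>j\<close>, over \<open>i\<close>, or over both, gives back the
  marginal bounds because \<open>R\<close> has total mass 1.
\<close>

text \<open>The row space has dimension at most 1, so it lies in the line spanned by a single vector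
  \<open>b\<close>; the coefficient of row \<open>i\<close> along \<open>b\<close> is
  \<open>c i\<close>.\<close>

lemma rank_le_1_outer_product:
  fixes X :: "real ^ 'n ^ 'm"
  assumes "rank X \<le> 1"
  obtains c :: "'m \<Rightarrow> real" and b :: "real ^ 'n" where "\<And>i j. X $ i $ j = c i * b $ j"
proof -
  obtain B where B: "independent B" "rows X \<subseteq> span B" "card B = rank X"
    using basis_exists[of "rows X"] by (metis row_rank_def)
  from B(1) have "finite B" by (rule independent_imp_finite)
  \<comment> \<open>Inclusion rather than equality also covers rank 0, where \<open>B\<close> is
    empty and \<open>b\<close> is arbitrary.\<close>
  then obtain b where "B \<subseteq> {b}"
    using assms B(3) by (metis One_nat_def card_1_singletonE card_eq_0_iff empty_subsetI le_SucE le_zero_eq order_refl)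
  then have "rows X \<subseteq> span {b}"
    using B(2) span_mono by blast
  then have "\<exists>k. row i X = k *\<^sub>R b" for i
    by (auto simp: rows_def span_singleton)
  then obtain c where "row i X = c i *\<^sub>R b" for i
    by metis
  then have "X $ i $ j = c i * b $ j" for i j
    by (metis row_def vec_lambda_eta vector_scaleR_component real_scaleR_def)
  then show thesis by (rule that)
qed

text \<open>With entries \<open>c i * b $ j\<close>, both sides equal \<open>c i * b $ j\<close>
  times the sum of all \<open>c i'\<close> times the sum of all \<open>b $ j'\<close>.\<close>

lemma rank_le_1_marginals:
  fixes X :: "real ^ 'n ^ 'm"
  assumes "rank X \<le> 1"
  shows "X $ i $ j * (\<Sum>i'\<in>UNIV. \<Sum>j'\<in>UNIV. X $ i' $ j') =
    (\<Sum>j'\<in>UNIV. X $ i $ j') * (\<Sum>i'\<in>UNIV. X $ i' $ j)"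
proof -
  obtain c b where X: "\<And>i j. X $ i $ j = c i * b $ j"
    using rank_le_1_outer_product[OF assms] by blast
  have "(\<Sum>i'\<in>UNIV. \<Sum>j'\<in>UNIV. X $ i' $ j') = (\<Sum>i'\<in>UNIV. c i') * (\<Sum>j'\<in>UNIV. b $ j')"
    by (simp add: X sum_product)
  moreover have "(\<Sum>j'\<in>UNIV. X $ i $ j') = c i * (\<Sum>j'\<in>UNIV. b $ j')"
    by (simp add: X sum_distrib_left)
  moreover have "(\<Sum>i'\<in>UNIV. X $ i' $ j) = (\<Sum>i'\<in>UNIV. c i') * b $ j"
    by (simp add: X sum_distrib_right)
  ultimately show ?thesis by (simp add: X)
qed

lemma rank1_transport2_subset:
  fixes l u :: "real ^ 'm" and l' u' :: "real ^ 'n"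
  shows "rank1_transport2 l u l' u' L U \<subseteq> rank1_transport l u l' u' L U"
proof
  fix X assume "X \<in> rank1_transport2 l u l' u' L U"
  then obtain R :: "real ^ 'n ^ 'm" where X: "nonneg_matrix X" "rank X \<le> 1"
    and row: "\<And>i j. l $ i * (\<Sum>i'\<in>UNIV. R $ i' $ j) \<le> X $ i $ j"
      "\<And>i j. X $ i $ j \<le> u $ i * (\<Sum>i'\<in>UNIV. R $ i' $ j)"
    and tot: "\<And>i j. L * R $ i $ j \<le> X $ i $ j" "\<And>i j. X $ i $ j \<le> U * R $ i $ j"
    and col: "\<And>i j. l' $ j * (\<Sum>j'\<in>UNIV. R $ i $ j') \<le> X $ i $ j"
      "\<And>i j. X $ i $ j \<le> u' $ j * (\<Sum>j'\<in>UNIV. R $ i $ j')"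
    and mass: "(\<Sum>i\<in>UNIV. \<Sum>j\<in>UNIV. R $ i $ j) = 1"
    unfolding rank1_transport2_def by blast
  \<comment> \<open>The row bounds carry column sums of \<open>R\<close> as weights; summing over
    \<open>j\<close> adds these up, so the total mass appears in the exchanged order.\<close>
  have mass': "(\<Sum>j\<in>UNIV. \<Sum>i\<in>UNIV. R $ i $ j) = 1"
    using mass by (subst sum.swap)
  have "l $ i \<le> (\<Sum>j\<in>UNIV. X $ i $ j)" "(\<Sum>j\<in>UNIV. X $ i $ j) \<le> u $ i" for i
  proof -
    have "(\<Sum>j\<in>UNIV. l $ i * (\<Sum>i'\<in>UNIV. R $ i' $ j)) \<le> (\<Sum>j\<in>UNIV. X $ i $ j)"
      "(\<Sum>j\<in>UNIV. X $ i $ j) \<le> (\<Sum>j\<in>UNIV. u $ i * (\<Sum>i'\<in>UNIV. R $ i' $ j))"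
      by (intro sum_mono row)+
    then show "l $ i \<le> (\<Sum>j\<in>UNIV. X $ i $ j)" "(\<Sum>j\<in>UNIV. X $ i $ j) \<le> u $ i"
      by (simp_all add: mass' flip: sum_distrib_left)
  qed
  moreover have "l' $ j \<le> (\<Sum>i\<in>UNIV. X $ i $ j)" "(\<Sum>i\<in>UNIV. X $ i $ j) \<le> u' $ j" for j
  proof -
    have "(\<Sum>i\<in>UNIV. l' $ j * (\<Sum>j'\<in>UNIV. R $ i $ j')) \<le> (\<Sum>i\<in>UNIV. X $ i $ j)"
      "(\<Sum>i\<in>UNIV. X $ i $ j) \<le> (\<Sum>i\<in>UNIV. u' $ j * (\<Sum>j'\<in>UNIV. R $ i $ j'))"
      by (intro sum_mono col)+
    then show "l' $ j \<le> (\<Sum>i\<in>UNIV. X $ i $ j)" "(\<Sum>i\<in>UNIV. X $ i $ j) \<le> u' $ j"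
      by (simp_all add: mass flip: sum_distrib_left)
  qed
  moreover have "L \<le> (\<Sum>i\<in>UNIV. \<Sum>j\<in>UNIV. X $ i $ j)"
    "(\<Sum>i\<in>UNIV. \<Sum>j\<in>UNIV. X $ i $ j) \<le> U"
  proof -
    have "(\<Sum>i\<in>UNIV. \<Sum>j\<in>UNIV. L * R $ i $ j) \<le> (\<Sum>i\<in>UNIV. \<Sum>j\<in>UNIV. X $ i $ j)"
      "(\<Sum>i\<in>UNIV. \<Sum>j\<in>UNIV. X $ i $ j) \<le> (\<Sum>i\<in>UNIV. \<Sum>j\<in>UNIV. U * R $ i $ j)"
      by (intro sum_mono tot)+
    then show "L \<le> (\<Sum>i\<in>UNIV. \<Sum>j\<in>UNIV. X $ i $ j)"
      "(\<Sum>i\<in>UNIV. \<Sum>j\<in>UNIV. X $ i $ j) \<le> U"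
      by (simp_all add: mass flip: sum_distrib_left)
  qed
  ultimately show "X \<in> rank1_transport l u l' u' L U"
    using X unfolding rank1_transport_def by blast
qed

text \<open>The sign hypotheses enter when \<open>X\<close> vanishes: the upper bounds then ask that
  \<open>u\<close>, \<open>u'\<close> and \<open>U\<close> times nonnegative quantities be
  nonnegative.\<close>

lemma rank1_transport_subset:
  fixes l u :: "real ^ 'm" and l' u' :: "real ^ 'n"
  assumes u: "\<And>i. 0 \<le> u $ i" and u': "\<And>j. 0 \<le> u' $ j" and U: "0 \<le> U"
  shows "rank1_transport l u l' u' L U \<subseteq> rank1_transport2 l u l' u' L U"
proof
  fix X assume "X \<in> rank1_transport l u l' u' L U"
  then have nonneg: "\<And>i j. 0 \<le> X $ i $ j" and rank: "rank X \<le> 1"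
    and row: "\<And>i. l $ i \<le> (\<Sum>j\<in>UNIV. X $ i $ j)" "\<And>i. (\<Sum>j\<in>UNIV. X $ i $ j) \<le> u $ i"
    and col: "\<And>j. l' $ j \<le> (\<Sum>i\<in>UNIV. X $ i $ j)" "\<And>j. (\<Sum>i\<in>UNIV. X $ i $ j) \<le> u' $ j"
    and tot: "L \<le> (\<Sum>i\<in>UNIV. \<Sum>j\<in>UNIV. X $ i $ j)" "(\<Sum>i\<in>UNIV. \<Sum>j\<in>UNIV. X $ i $ j) \<le> U"
    unfolding rank1_transport_def nonneg_matrix_def by blast+
  define S where "S = (\<Sum>i\<in>UNIV. \<Sum>j\<in>UNIV. X $ i $ j)"
  have S_nonneg: "0 \<le> S"
    unfolding S_def by (intro sum_nonneg nonneg)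
  have col_nonneg: "0 \<le> (\<Sum>i\<in>UNIV. X $ i $ j)" for j
    by (intro sum_nonneg nonneg)
  have row_nonneg: "0 \<le> (\<Sum>j\<in>UNIV. X $ i $ j)" for i
    by (intro sum_nonneg nonneg)
  show "X \<in> rank1_transport2 l u l' u' L U"
  proof (cases "S = 0")
    case True
    then have X0: "X $ i $ j = 0" for i j
      unfolding S_def using nonneg row_nonneg by (simp add: sum_nonneg_eq_0_iff)
    \<comment> \<open>The uniform distribution on the index pairs.\<close>
    define R :: "real ^ 'n ^ 'm" where
      "R = (\<chi> i j. 1 / (real CARD('m) * real CARD('n)))"
    have R: "0 \<le> R $ i $ j" for i j
      by (simp add: R_def)
    have "0 \<le> (\<Sum>i\<in>UNIV. R $ i $ j)" "0 \<le> (\<Sum>j\<in>UNIV. R $ i $ j)" for i j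
      by (intro sum_nonneg R)+
    moreover have "(\<Sum>i\<in>UNIV. \<Sum>j\<in>UNIV. R $ i $ j) = 1"
      by (simp add: R_def)
    moreover have "l $ i \<le> 0" "l' $ j \<le> 0" "L \<le> 0" for i j
      using row(1)[of i] col(1)[of j] tot(1) by (simp_all add: X0)
    ultimately show ?thesis
      unfolding rank1_transport2_def nonneg_matrix_def
      using R rank u u' U
      by (auto simp: X0 mult_nonpos_nonneg intro!: exI[of _ R])
  next
    case False
    with S_nonneg have S: "0 < S" by simp
    \<comment> \<open>This choice is forced by the equation
      \<open>X $ i $ j = R $ i $ j * S\<close>.\<close>
    define R :: "real ^ 'n ^ 'm" where "R = (\<chi> i j. X $ i $ j / S)"
    have R: "R $ i $ j = X $ i $ j / S" for i j
      by (simp add: R_def)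
    have colR: "(\<Sum>i\<in>UNIV. R $ i $ j) = (\<Sum>i\<in>UNIV. X $ i $ j) / S" for j
      by (simp add: R sum_divide_distrib)
    have rowR: "(\<Sum>j\<in>UNIV. R $ i $ j) = (\<Sum>j\<in>UNIV. X $ i $ j) / S" for i
      by (simp add: R sum_divide_distrib)
    have X: "X $ i $ j = (\<Sum>j\<in>UNIV. X $ i $ j) * (\<Sum>i\<in>UNIV. X $ i $ j) / S" for i j
      using rank_le_1_marginals[OF rank, of i j] S by (simp add: S_def field_simps)
    have "l $ i * (\<Sum>i'\<in>UNIV. R $ i' $ j) \<le> X $ i $ j"
      "X $ i $ j \<le> u $ i * (\<Sum>i'\<in>UNIV. R $ i' $ j)" for i j
      \<comment> \<open>Both sides now share the factor column sum over \<open>S\<close>, so the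
        claims reduce to the bounds on the row sum.\<close>
      unfolding colR X[of i j] times_divide_eq_right
      by (intro divide_right_mono mult_right_mono row col_nonneg S_nonneg)+
    moreover have "l' $ j * (\<Sum>j'\<in>UNIV. R $ i $ j') \<le> X $ i $ j"
      "X $ i $ j \<le> u' $ j * (\<Sum>j'\<in>UNIV. R $ i $ j')" for i j
      \<comment> \<open>Here the row sum is the common factor; commuting moves it to the right, as
        \<open>mult_right_mono\<close> expects.\<close>
      unfolding rowR X[of i j] times_divide_eq_right mult.commute[of "\<Sum>j\<in>UNIV. X $ i $ j"]
      by (intro divide_right_mono mult_right_mono col row_nonneg S_nonneg)+
    moreover have "L * R $ i $ j \<le> X $ i $ j" "X $ i $ j \<le> U * R $ i $ j" for i j
      \<comment> \<open>Cleared of the denominator, these are L \<le> S and S \<le> U multiplied by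
        the entry of \<open>X\<close>.\<close>
      using S tot[folded S_def] nonneg[of i j] mult_right_mono[of _ _ "X $ i $ j"]
      by (simp_all add: R field_simps)
    moreover have "X $ i $ j = R $ i $ j * (\<Sum>i'\<in>UNIV. \<Sum>j'\<in>UNIV. X $ i' $ j')" for i j
      using S by (simp add: R flip: S_def)
    moreover have "(\<Sum>i\<in>UNIV. \<Sum>j\<in>UNIV. R $ i $ j) = 1"
      unfolding rowR using S by (simp add: S_def flip: sum_divide_distrib)
    moreover have "0 \<le> R $ i $ j" for i j
      using S nonneg by (simp add: R)
    ultimately show ?thesis
      unfolding rank1_transport2_def nonneg_matrix_def
      using nonneg rank by blast
  qed
qed

theorem proposition4:
  fixes l u :: "real ^ 'm" and l' u' :: "real ^ 'n" and L U :: real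
  assumes "\<And>i. 0 \<le> l $ i" and "\<And>i. 0 \<le> u $ i"
    and "\<And>j. 0 \<le> l' $ j" and "\<And>j. 0 \<le> u' $ j"
    and "0 \<le> L" and "0 \<le> U"
    and "\<And>i. l $ i \<le> u $ i" and "\<And>j. l' $ j \<le> u' $ j" and "L \<le> U"
    and "\<And>i. 0 < u $ i" and "\<And>j. 0 < u' $ j"
  shows "rank1_transport l u l' u' L U = rank1_transport2 l u l' u' L U"
  using rank1_transport_subset[OF assms(2,4,6)] rank1_transport2_subset
  by (rule subset_antisym)

end
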